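(* Suppose that the identity $$R_{s,t}(z_1,\ldots,z_{s+t-1}) = R_{s,t}(z_1^{-1},\ldots,z_{s+t-1}^{-1})$$ of rational functions (with $R_{s,t}$ as defined in the context) holds for all integers $s \ge 1$ with $t=s$ and for all integers $s\ge 1$ with $t=s+1$. Then the identity holds for all integers $s,t$ with $1 \le s \le t$.
   Context: For a function $p$ in $n$ variables, $\mathbf{Sym}\, p(x_1,\ldots,x_n) := \sum_{\sigma \in \mathcal{S}_n} p(x_{\sigma(1)},\ldots,x_{\sigma(n)})$ (unnormalized symmetrizer). Define the rational function $$P_{s,t}(z_1,\ldots,z_{s+t-1}):= \prod_{i=1}^{s} z_i^{2s-2i-t+1} (1-z_i^{-1})^{i-1} \prod_{i=s+1}^{s+t-1} z_i^{2i-2s-t} (1-z_i^{-1})^s \prod_{1 \le p < q \le s+t-1} \frac{1 - z_p + z_p z_q}{z_q - z_p}$$ and $R_{s,t}(z_1,\ldots,z_{s+t-1}) := \mathbf{Sym}\, P_{s,t}(z_1,\ldots,z_{s+t-1})$, where the symmetrizer runs over $\mathcal{S}_{s+t-1}$. *)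

theory Defs
  imports
    "HOL-Library.Poly_Mapping"
    "HOL-Computational_Algebra.Fraction_Field"
    "HOL-Combinatorics.Permutations"
begin

text \<open>
  The rational function field over \<open>'k\<close> in variables indexed by the natural numbers: the fraction
  field of the polynomial ring whose monomials are finitely supported exponent vectors
  \<open>nat \<Rightarrow>\<^sub>0 nat\<close>.  The field of rational functions in \<open>z\<^sub>1, \<dots>, z\<^sub>n\<close> is a subfield of it, so an
  identity between rational functions in \<open>z\<^sub>1, \<dots>, z\<^sub>n\<close> is an equality in this type.
\<close>

type_synonym 'k ratfun = "((nat \<Rightarrow>\<^sub>0 nat) \<Rightarrow>\<^sub>0 'k) fract"

definition rvar :: "nat \<Rightarrow> 'k :: field ratfun" where
  "rvar i = Fract (Poly_Mapping.single (Poly_Mapping.single i 1) 1) 1"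

lemma rvar_nonzero: "(rvar i :: 'k :: field ratfun) \<noteq> 0"
proof -
  have "Poly_Mapping.single (Poly_Mapping.single i (1::nat)) (1::'k) \<noteq> 0"
    by (metis lookup_single_eq lookup_zero zero_neq_one)
  then show ?thesis
    by (simp add: rvar_def Zero_fract_def eq_fract)
qed

lemma rvar_eq_iff: "(rvar i :: 'k :: field ratfun) = rvar j \<longleftrightarrow> i = j"
proof
  assume "(rvar i :: 'k ratfun) = rvar j"
  then have "(Poly_Mapping.single (Poly_Mapping.single i (1::nat)) (1::'k))
           = Poly_Mapping.single (Poly_Mapping.single j 1) 1"
    by (simp add: rvar_def eq_fract)
  then have "Poly_Mapping.single i (1::nat) = Poly_Mapping.single j 1"
    by (metis lookup_single_eq lookup_single_not_eq zero_neq_one)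
  then show "i = j"
    by (metis lookup_single_eq lookup_single_not_eq zero_neq_one)
qed simp

definition Sym :: "nat \<Rightarrow> ((nat \<Rightarrow> 'a) \<Rightarrow> 'a) \<Rightarrow> (nat \<Rightarrow> 'a) \<Rightarrow> 'a :: comm_monoid_add" where
  "Sym n p x = (\<Sum>\<sigma> | \<sigma> permutes {1..n}. p (\<lambda>i. x (\<sigma> i)))"

text \<open>
  The rational expressions are evaluated at a point \<open>z\<close> with coordinates in any field (only
  \<open>z 1, \<dots>, z (s + t - 1)\<close> matter).  Evaluation at \<^const>\<open>rvar\<close> gives the rational function itself;
  evaluation at \<open>\<lambda>i. inverse (rvar i)\<close> is the substitution of \<open>z\<^sub>i\<close> by its inverse.  By
  \<open>rvar_nonzero\<close> and \<open>rvar_eq_iff\<close> no division by zero occurs in either case.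
\<close>

definition P :: "nat \<Rightarrow> nat \<Rightarrow> (nat \<Rightarrow> 'a) \<Rightarrow> 'a :: field" where
  "P s t z =
     (\<Prod>i = 1..s. z i powi (2 * int s - 2 * int i - int t + 1) * (1 - inverse (z i)) ^ (i - 1)) *
     (\<Prod>i = s + 1..s + t - 1. z i powi (2 * int i - 2 * int s - int t) * (1 - inverse (z i)) ^ s) *
     (\<Prod>(p, q) \<in> {(p, q). 1 \<le> p \<and> p < q \<and> q \<le> s + t - 1}.
        (1 - z p + z p * z q) / (z q - z p))"

definition R :: "nat \<Rightarrow> nat \<Rightarrow> (nat \<Rightarrow> 'a) \<Rightarrow> 'a :: field" where
  "R s t = Sym (s + t - 1) (P s t)"

end

theory Submission
  imports Defs
begin

text \<open>
  At \<open>z\<^sub>1 = 1\<close> the factors \<open>1 - z\<^sup>-\<^sup>1\<close> annihilate every summand of \<open>R\<^sub>s\<^sub>+\<^sub>1\<^sub>,\<^sub>t\<close> in which \<open>z\<^sub>1\<close>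
  is not in the first position, and in the remaining summands the factors
  \<open>(1 - z\<^sub>1 + z\<^sub>1z\<^sub>q) / (z\<^sub>q - z\<^sub>1) = 1 / (1 - z\<^sub>q\<^sup>-\<^sup>1)\<close> lower the exponents of \<open>1 - z\<^sub>q\<^sup>-\<^sup>1\<close> by one.
  Hence \<open>R\<^sub>s\<^sub>+\<^sub>1\<^sub>,\<^sub>t(1, z) = R\<^sub>s\<^sub>,\<^sub>t(z)\<close>, and since \<open>1\<close> is its own inverse, the identity for
  \<open>(s + 1, t)\<close> implies the one for \<open>(s, t)\<close>: one descends from \<open>(t, t)\<close>.
\<close>

section \<open>Specialization of rational functions\<close>

text \<open>\<open>h\<close> embeds the coefficients and \<open>y\<close> is the point. The values
  live in a second field \<open>'b\<close>, so that coordinates may themselves be rational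
  functions: a specialized identity is then again one between rational functions, with no argument
  through sufficiently many points over \<open>'k\<close>.\<close>

locale point_evaluation =
  fixes h :: "'k :: field \<Rightarrow> 'b :: field" and y :: "nat \<Rightarrow> 'b"
  assumes h_0 [simp]: "h 0 = 0" and h_1 [simp]: "h 1 = 1"
    and h_add: "h (a + b) = h a + h b" and h_mult: "h (a * b) = h a * h b"
begin

section \<open>Evaluation of polynomials as a ring homomorphism\<close>

definition eval_monom :: "(nat \<Rightarrow>\<^sub>0 nat) \<Rightarrow> 'b" where
  "eval_monom m = (\<Prod>i\<in>Poly_Mapping.keys m. y i ^ Poly_Mapping.lookup m i)"

definition eval_poly :: "((nat \<Rightarrow>\<^sub>0 nat) \<Rightarrow>\<^sub>0 'k) \<Rightarrow> 'b" where
  "eval_poly p = (\<Sum>m\<in>Poly_Mapping.keys p. h (Poly_Mapping.lookup p m) * eval_monom m)"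

lemma eval_monom_superset:
  assumes "finite A" "Poly_Mapping.keys m \<subseteq> A"
  shows "eval_monom m = (\<Prod>i\<in>A. y i ^ Poly_Mapping.lookup m i)"
  unfolding eval_monom_def
  by (rule prod.mono_neutral_left) (use assms in \<open>auto simp: in_keys_iff\<close>)

lemma eval_poly_superset:
  assumes "finite A" "Poly_Mapping.keys p \<subseteq> A"
  shows "eval_poly p = (\<Sum>m\<in>A. h (Poly_Mapping.lookup p m) * eval_monom m)"
  unfolding eval_poly_def
  by (rule sum.mono_neutral_left) (use assms in \<open>auto simp: in_keys_iff\<close>)

lemma eval_monom_add: "eval_monom (m + n) = eval_monom m * eval_monom n"
proof -
  let ?A = "Poly_Mapping.keys m \<union> Poly_Mapping.keys n"
  have "eval_monom (m + n) = (\<Prod>i\<in>?A. y i ^ Poly_Mapping.lookup (m + n) i)"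
    by (rule eval_monom_superset) (auto dest: subsetD[OF keys_add])
  also have "\<dots> = (\<Prod>i\<in>?A. y i ^ Poly_Mapping.lookup m i) * (\<Prod>i\<in>?A. y i ^ Poly_Mapping.lookup n i)"
    by (simp add: lookup_add power_add prod.distrib)
  also have "\<dots> = eval_monom m * eval_monom n"
    by (simp add: eval_monom_superset[of ?A])
  finally show ?thesis .
qed

lemma eval_poly_0 [simp]: "eval_poly 0 = 0"
  by (simp add: eval_poly_def)

lemma eval_poly_add: "eval_poly (p + q) = eval_poly p + eval_poly q"
proof -
  let ?A = "Poly_Mapping.keys p \<union> Poly_Mapping.keys q"
  have "eval_poly (p + q) = (\<Sum>m\<in>?A. h (Poly_Mapping.lookup (p + q) m) * eval_monom m)"
    by (rule eval_poly_superset) (auto dest: subsetD[OF keys_add])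
  also have "\<dots> = (\<Sum>m\<in>?A. h (Poly_Mapping.lookup p m) * eval_monom m) + (\<Sum>m\<in>?A. h (Poly_Mapping.lookup q m) * eval_monom m)"
    by (simp add: lookup_add h_add ring_distribs sum.distrib)
  also have "\<dots> = eval_poly p + eval_poly q"
    by (simp add: eval_poly_superset[of ?A])
  finally show ?thesis .
qed

lemma eval_poly_minus: "eval_poly (- p) = - eval_poly p"
  using eval_poly_add[of p "- p"] by (simp add: eq_neg_iff_add_eq_0 add.commute)

lemma eval_poly_sum: "eval_poly (\<Sum>i\<in>A. f i) = (\<Sum>i\<in>A. eval_poly (f i))"
  by (induction A rule: infinite_finite_induct) (auto simp: eval_poly_add)

lemma eval_poly_single: "eval_poly (Poly_Mapping.single m c) = h c * eval_monom m"
  by (cases "c = 0") (auto simp: eval_poly_def)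

lemma eval_poly_1 [simp]: "eval_poly 1 = 1"
  using eval_poly_single[of 0 1] by (simp add: eval_monom_def)

lemma eval_poly_rvar:
  "eval_poly (Poly_Mapping.single (Poly_Mapping.single i 1) 1) = y i"
  by (simp add: eval_poly_single eval_monom_def)

lemma sum_single_lookup: "(\<Sum>m\<in>Poly_Mapping.keys p. Poly_Mapping.single m (Poly_Mapping.lookup p m)) = p"
  by (rule poly_mapping_eqI) (simp add: lookup_sum lookup_single when_def in_keys_iff)

text \<open>Both factors are expanded into single monomials by \<open>sum_single_lookup\<close>; on
  these, \<open>mult_single\<close> adds exponents and multiplies coefficients, which
  \<open>eval_monom_add\<close> and \<open>h_mult\<close> respect.\<close>

lemma eval_poly_mult: "eval_poly (p * q) = eval_poly p * eval_poly q"
proof -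
  have "p * q = (\<Sum>m\<in>Poly_Mapping.keys p. \<Sum>n\<in>Poly_Mapping.keys q.
      Poly_Mapping.single m (Poly_Mapping.lookup p m) * Poly_Mapping.single n (Poly_Mapping.lookup q n))"
    by (simp flip: sum_product add: sum_single_lookup)
  then have "eval_poly (p * q) = (\<Sum>m\<in>Poly_Mapping.keys p. \<Sum>n\<in>Poly_Mapping.keys q.
      (h (Poly_Mapping.lookup p m) * eval_monom m) * (h (Poly_Mapping.lookup q n) * eval_monom n))"
    by (simp add: eval_poly_sum mult_single eval_poly_single h_mult eval_monom_add mult_ac)
  also have "\<dots> = eval_poly p * eval_poly q"
    by (simp add: eval_poly_def sum_product)
  finally show ?thesis .
qed

section \<open>Values of rational functions at a point\<close>

text \<open>A relation, because a rational function has no value at a pole, and even a regular one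
  has representations whose denominator vanishes at the point. One good representation
  suffices.\<close>

definition specializes :: "'k ratfun \<Rightarrow> 'b \<Rightarrow> bool" where
  "specializes x a \<longleftrightarrow> (\<exists>p q. x = Fract p q \<and> eval_poly q \<noteq> 0 \<and> a = eval_poly p / eval_poly q)"

lemma specializesE:
  assumes "specializes x a"
  obtains p q where "x = Fract p q" "q \<noteq> 0" "eval_poly q \<noteq> 0" "a = eval_poly p / eval_poly q"
  using assms unfolding specializes_def by (metis eval_poly_0)

lemma specializesI:
  "eval_poly q \<noteq> 0 \<Longrightarrow> specializes (Fract p q) (eval_poly p / eval_poly q)"
  by (auto simp: specializes_def)

text \<open>Cross-multiplying turns equality of fractions into a polynomial identity, which
  evaluation preserves; the nonvanishing denominators allow dividing back.\<close>

lemma specializes_unique: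
  assumes "specializes x a" "specializes x b"
  shows "a = b"
proof -
  obtain p q where pq: "x = Fract p q" "q \<noteq> 0" "eval_poly q \<noteq> 0" "a = eval_poly p / eval_poly q"
    by (rule specializesE[OF assms(1)])
  obtain p' q' where pq': "x = Fract p' q'" "q' \<noteq> 0" "eval_poly q' \<noteq> 0"
      "b = eval_poly p' / eval_poly q'"
    by (rule specializesE[OF assms(2)])
  have "p * q' = p' * q"
    using pq pq' by (simp add: eq_fract)
  then have "eval_poly p * eval_poly q' = eval_poly p' * eval_poly q"
    by (metis eval_poly_mult)
  then show ?thesis
    using pq pq' by (simp add: frac_eq_eq)
qed

lemma specializes_rvar: "specializes (rvar i) (y i)"
  using specializesI[of 1 "Poly_Mapping.single (Poly_Mapping.single i 1) 1"]
  by (simp add: rvar_def eval_poly_rvar del: One_nat_def)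

lemma specializes_0: "specializes 0 0"
  using specializesI[of 1 0] by (simp add: Zero_fract_def)

lemma specializes_1: "specializes 1 1"
  using specializesI[of 1 1] by (simp add: One_fract_def)

lemma specializes_add:
  assumes "specializes x a" "specializes x' a'"
  shows "specializes (x + x') (a + a')"
proof -
  obtain p q where pq: "x = Fract p q" "q \<noteq> 0" "eval_poly q \<noteq> 0" "a = eval_poly p / eval_poly q"
    by (rule specializesE[OF assms(1)])
  obtain p' q' where pq': "x' = Fract p' q'" "q' \<noteq> 0" "eval_poly q' \<noteq> 0"
      "a' = eval_poly p' / eval_poly q'"
    by (rule specializesE[OF assms(2)])
  have "x + x' = Fract (p * q' + p' * q) (q * q')"
    using pq pq' by simp
  moreover have "a + a' = eval_poly (p * q' + p' * q) / eval_poly (q * q')"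
    using pq pq' by (simp add: eval_poly_add eval_poly_mult add_frac_eq)
  ultimately show ?thesis
    using specializesI[of "q * q'"] pq pq' by (simp add: eval_poly_mult)
qed

lemma specializes_mult:
  assumes "specializes x a" "specializes x' a'"
  shows "specializes (x * x') (a * a')"
proof -
  obtain p q where pq: "x = Fract p q" "q \<noteq> 0" "eval_poly q \<noteq> 0" "a = eval_poly p / eval_poly q"
    by (rule specializesE[OF assms(1)])
  obtain p' q' where pq': "x' = Fract p' q'" "q' \<noteq> 0" "eval_poly q' \<noteq> 0"
      "a' = eval_poly p' / eval_poly q'"
    by (rule specializesE[OF assms(2)])
  show ?thesis
    using specializesI[of "q * q'" "p * p'"] pq pq' by (simp add: eval_poly_mult)
qed

lemma specializes_minus: "specializes x a \<Longrightarrow> specializes (- x) (- a)"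
  by (elim specializesE) (metis eval_poly_minus minus_divide_left minus_fract specializesI)

lemma specializes_diff:
  "specializes x a \<Longrightarrow> specializes x' a' \<Longrightarrow> specializes (x - x') (a - a')"
  using specializes_add[OF _ specializes_minus] by fastforce

text \<open>A nonzero value means that the numerator does not vanish at the point, so the flipped
  fraction is admissible.\<close>

lemma specializes_inverse:
  assumes "specializes x a" "a \<noteq> 0"
  shows "specializes (inverse x) (inverse a)"
proof -
  obtain p q where pq: "x = Fract p q" "q \<noteq> 0" "eval_poly q \<noteq> 0" "a = eval_poly p / eval_poly q"
    by (rule specializesE[OF assms(1)])
  then show ?thesis
    using specializesI[of p q] assms(2) by simp
qed

lemma specializes_divide:
  "specializes x a \<Longrightarrow> specializes x' a' \<Longrightarrow> a' \<noteq> 0 \<Longrightarrow> specializes (x / x') (a / a')"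
  by (simp add: divide_inverse specializes_mult specializes_inverse)

lemma specializes_power: "specializes x a \<Longrightarrow> specializes (x ^ n) (a ^ n)"
  by (induction n) (auto intro: specializes_1 specializes_mult)

lemma specializes_powi: "specializes x a \<Longrightarrow> a \<noteq> 0 \<Longrightarrow> specializes (x powi n) (a powi n)"
  by (simp add: power_int_def specializes_power specializes_inverse)

lemma specializes_sum:
  "(\<And>i. i \<in> A \<Longrightarrow> specializes (f i) (g i)) \<Longrightarrow> specializes (\<Sum>i\<in>A. f i) (\<Sum>i\<in>A. g i)"
  by (induction A rule: infinite_finite_induct) (auto intro: specializes_0 specializes_add)

lemma specializes_prod:
  "(\<And>i. i \<in> A \<Longrightarrow> specializes (f i) (g i)) \<Longrightarrow> specializes (\<Prod>i\<in>A. f i) (\<Prod>i\<in>A. g i)"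
  by (induction A rule: infinite_finite_induct) (auto intro: specializes_1 specializes_mult)

section \<open>Values of \<open>P\<close> and \<open>R\<close> at a point\<close>

text \<open>Nonzero coordinates take care of inverses and negative powers, distinct ones of the
  denominators \<open>z q - z p\<close>. With \<open>t \<ge> 1\<close> the positions
  \<open>1..s\<close> of the first product lie within \<open>1..s + t - 1\<close>, where the
  hypotheses apply.\<close>

lemma specializes_P:
  assumes "t \<ge> 1"
    and x: "\<And>i. i \<in> {1..s + t - 1} \<Longrightarrow> specializes (x i) (a i)"
    and nz: "\<And>i. i \<in> {1..s + t - 1} \<Longrightarrow> a i \<noteq> 0"
    and inj: "inj_on a {1..s + t - 1}"
  shows "specializes (P s t x) (P s t a)"
proof -
  have factor: "specializes (x i powi k * (1 - inverse (x i)) ^ n) (a i powi k * (1 - inverse (a i)) ^ n)"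
    if "i \<in> {1..s + t - 1}" for i k n
    using x[OF that] nz[OF that]
    by (intro specializes_mult specializes_power specializes_diff specializes_1
        specializes_inverse specializes_powi)
  have pair: "specializes ((1 - x p + x p * x q) / (x q - x p)) ((1 - a p + a p * a q) / (a q - a p))"
    if "1 \<le> p" "p < q" "q \<le> s + t - 1" for p q
  proof -
    have "a q \<noteq> a p"
      using inj that by (auto dest!: inj_onD)
    then show ?thesis
      using x[of p] x[of q] that
      by (intro specializes_divide specializes_add specializes_mult specializes_diff specializes_1) auto
  qed
  show ?thesis
    unfolding P_def
    by (intro specializes_mult specializes_prod factor) (use \<open>t \<ge> 1\<close> in \<open>auto intro: pair\<close>)
qed

lemma specializes_R:
  assumes "t \<ge> 1"
    and "\<And>i. i \<in> {1..s + t - 1} \<Longrightarrow> specializes (x i) (a i)"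
    and "\<And>i. i \<in> {1..s + t - 1} \<Longrightarrow> a i \<noteq> 0"
    and "inj_on a {1..s + t - 1}"
  shows "specializes (R s t x) (R s t a)"
  unfolding R_def Sym_def
proof (intro specializes_sum specializes_P \<open>t \<ge> 1\<close>)
  fix \<sigma> assume "\<sigma> \<in> {\<sigma>. \<sigma> permutes {1..s + t - 1}}"
  then have \<sigma>: "\<sigma> permutes {1..s + t - 1}"
    by simp
  show "specializes (x (\<sigma> i)) (a (\<sigma> i))" if "i \<in> {1..s + t - 1}" for i
    using assms(2) that permutes_in_image[OF \<sigma>] by blast
  show "a (\<sigma> i) \<noteq> 0" if "i \<in> {1..s + t - 1}" for i
    using assms(3) that permutes_in_image[OF \<sigma>] by blast
  show "inj_on (\<lambda>i. a (\<sigma> i)) {1..s + t - 1}"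
    using comp_inj_on[of \<sigma> "{1..s + t - 1}" a] assms(4) permutes_inj_on[OF \<sigma>] permutes_image[OF \<sigma>]
    by (simp add: comp_def)
qed

end

text \<open>Both sides of the assumed identity have a value at the point, and values are unique. On
  the right, \<open>inverse (a i)\<close> is the value of \<open>inverse (rvar i)\<close>; these
  inverses are again nonzero and distinct.\<close>

lemma R_inverse_specialize:
  fixes h :: "'k :: field \<Rightarrow> 'b :: field" and a :: "nat \<Rightarrow> 'b"
  assumes "point_evaluation h"
    and "R s t (rvar :: nat \<Rightarrow> 'k ratfun) = R s t (\<lambda>i. inverse (rvar i))"
    and "t \<ge> 1" and nz: "\<And>i. i \<in> {1..s + t - 1} \<Longrightarrow> a i \<noteq> 0" and inj: "inj_on a {1..s + t - 1}"
  shows "R s t a = R s t (\<lambda>i. inverse (a i))"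
proof -
  \<comment> \<open>The locale predicate constrains \<open>h\<close> alone, so any point
    \<open>a\<close> may be supplied.\<close>
  interpret point_evaluation h a by fact
  have "specializes (R s t rvar) (R s t a)"
    by (rule specializes_R) (use assms specializes_rvar in auto)
  moreover have "specializes (R s t (\<lambda>i. inverse (rvar i))) (R s t (\<lambda>i. inverse (a i)))"
    by (rule specializes_R)
      (use assms specializes_rvar in \<open>auto intro: specializes_inverse simp: inj_on_def\<close>)
  ultimately show ?thesis
    using assms(2) specializes_unique by metis
qed

section \<open>Setting a variable to one\<close>

lemma P_cong:
  assumes "t \<ge> 1" and "\<And>i. i \<in> {1..s + t - 1} \<Longrightarrow> x i = y i"
  shows "P s t x = P s t y"
  unfolding P_def
  by (intro arg_cong2[of _ _ _ _ "(*)"] prod.cong) (use assms in auto)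

text \<open>Every position except the first carries \<open>1 - inverse (z i)\<close> with a positive
  exponent: \<open>i - 1\<close> up to position \<open>Suc s\<close>, and \<open>Suc s\<close>
  beyond it.\<close>

lemma P_Suc_eq_0:
  assumes "t \<ge> 1" and i: "i \<in> {2..s + t}" and "z i = 1"
  shows "P (Suc s) t z = 0"
proof (cases "i \<le> Suc s")
  case True
  then have "(\<Prod>i = 1..Suc s. z i powi (2 * int (Suc s) - 2 * int i - int t + 1) *
      (1 - inverse (z i)) ^ (i - 1)) = 0"
    using i \<open>z i = 1\<close> by (intro prod_zero bexI[of _ i]) auto
  then show ?thesis
    unfolding P_def by simp
next
  case False
  then have "(\<Prod>i = Suc s + 1..Suc s + t - 1. z i powi (2 * int i - 2 * int (Suc s) - int t) *
      (1 - inverse (z i)) ^ Suc s) = 0"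
    using i \<open>z i = 1\<close> by (intro prod_zero bexI[of _ i]) auto
  then show ?thesis
    unfolding P_def by simp
qed

text \<open>Splitting off the pairs with \<open>p = 1\<close> isolates all interactions of the first
  variable with the others.\<close>

lemma prod_pairs_shift:
  fixes f :: "nat \<Rightarrow> nat \<Rightarrow> 'a :: comm_monoid_mult"
  shows "(\<Prod>(p, q)\<in>{(p, q). 1 \<le> p \<and> p < q \<and> q \<le> Suc n}. f p q) =
    (\<Prod>q = 1..n. f 1 (Suc q)) * (\<Prod>(p, q)\<in>{(p, q). 1 \<le> p \<and> p < q \<and> q \<le> n}. f (Suc p) (Suc q))"
proof -
  let ?A = "(\<lambda>q. (1, Suc q)) ` {1..n}"
  let ?T = "{(p, q). 1 \<le> p \<and> p < q \<and> q \<le> n}"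
  let ?B = "(\<lambda>(p, q). (Suc p, Suc q)) ` ?T"
  have "finite ?T"
    by (rule finite_subset[of _ "{1..n} \<times> {1..n}"]) auto
  have "{(p, q). 1 \<le> p \<and> p < q \<and> q \<le> Suc n} = ?A \<union> ?B" (is "?L = _")
  proof (intro equalityI subsetI)
    fix x assume "x \<in> ?L"
    then obtain p q where x: "x = (p, Suc q)" "1 \<le> p" "p < Suc q" "q \<le> n"
      by (cases x; cases "snd x") auto
    show "x \<in> ?A \<union> ?B"
    proof (cases "p = 1")
      case True
      then show ?thesis using x by auto
    next
      case False
      then have "x = (\<lambda>(p, q). (Suc p, Suc q)) (p - 1, q)" "(p - 1, q) \<in> ?T"
        using x by auto
      then show ?thesis by blast
    qed
  qed auto
  moreover have "?A \<inter> ?B = {}"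
    by auto
  ultimately have "(\<Prod>(p, q)\<in>?L. f p q) = (\<Prod>(p, q)\<in>?A. f p q) * (\<Prod>(p, q)\<in>?B. f p q)"
    using \<open>finite ?T\<close> by (simp add: prod.union_disjoint)
  also have "(\<Prod>(p, q)\<in>?A. f p q) = (\<Prod>q = 1..n. f 1 (Suc q))"
    by (subst prod.reindex) (auto simp: inj_on_def)
  also have "(\<Prod>(p, q)\<in>?B. f p q) = (\<Prod>(p, q)\<in>?T. f (Suc p) (Suc q))"
    by (subst prod.reindex) (auto simp: inj_on_def case_prod_beta)
  finally show ?thesis .
qed

text \<open>The exponents of \<open>z\<close> depend only on \<open>s - i\<close> and
  \<open>t\<close>, so raising both \<open>s\<close> and \<open>i\<close> by one leaves them alone.
  Each exponent of \<open>1 - inverse (z i)\<close> is one too large, and the pairs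
  \<open>(1, q)\<close> contribute exactly the inverse of this surplus.\<close>

lemma P_Suc_at_1:
  assumes "t \<ge> 1" and z1: "z 1 = 1"
    and nz: "\<And>i. i \<in> {1..s + t - 1} \<Longrightarrow> z (Suc i) \<noteq> 0 \<and> z (Suc i) \<noteq> 1"
  shows "P (Suc s) t z = P s t (\<lambda>i. z (Suc i))"
proof -
  define w where "w i = 1 - inverse (z (Suc i))" for i
  define n where "n = s + t - 1"
  have n: "Suc s + t - 1 = Suc n" "s + t - 1 = n" "s \<le> n"
    using \<open>t \<ge> 1\<close> by (auto simp: n_def)
  \<comment> \<open>\<open>F\<close>, \<open>G\<close> and \<open>Q\<close> are the constituents of
    \<open>P s t\<close> at the shifted point; the single factors of \<open>P (Suc s) t\<close> turn
    out to be \<open>F i * w i\<close> and \<open>G i * w i\<close>.\<close>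
  define F where "F i = z (Suc i) powi (2 * int s - 2 * int i - int t + 1) * w i ^ (i - 1)" for i
  define G where "G i = z (Suc i) powi (2 * int i - 2 * int s - int t) * w i ^ s" for i
  define Q where "Q = (\<Prod>(p, q)\<in>{(p, q). 1 \<le> p \<and> p < q \<and> q \<le> n}.
      (1 - z (Suc p) + z (Suc p) * z (Suc q)) / (z (Suc q) - z (Suc p)))"
  \<comment> \<open>The factor at \<open>i = 1\<close> is a power of 1 times \<open>0 ^ 0\<close>,
    hence 1, and drops out.\<close>
  have "(\<Prod>i = 1..Suc s. z i powi (2 * int (Suc s) - 2 * int i - int t + 1) *
      (1 - inverse (z i)) ^ (i - 1)) = (\<Prod>i = Suc 1..Suc s. z i powi (2 * int (Suc s) - 2 * int i - int t + 1) *
      (1 - inverse (z i)) ^ (i - 1))"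
    by (subst prod.atLeast_Suc_atMost) (use z1 in auto)
  also have "\<dots> = (\<Prod>i = 1..s. F i * w i)"
    unfolding prod.shift_bounds_cl_Suc_ivl
  proof (rule prod.cong)
    fix i assume "i \<in> {1..s}"
    then have "w i ^ i = w i ^ (i - 1) * w i"
      by (cases i) auto
    then show "z (Suc i) powi (2 * int (Suc s) - 2 * int (Suc i) - int t + 1) *
        (1 - inverse (z (Suc i))) ^ (Suc i - 1) = F i * w i"
      by (simp add: F_def flip: w_def)
  qed simp
  finally have 1: "(\<Prod>i = 1..Suc s. z i powi (2 * int (Suc s) - 2 * int i - int t + 1) *
      (1 - inverse (z i)) ^ (i - 1)) = (\<Prod>i = 1..s. F i) * (\<Prod>i = 1..s. w i)"
    by (simp add: prod.distrib)
  have "(\<Prod>i = Suc s + 1..Suc n. z i powi (2 * int i - 2 * int (Suc s) - int t) *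
      (1 - inverse (z i)) ^ Suc s) = (\<Prod>i = s + 1..n. G i * w i)"
    unfolding add_Suc prod.shift_bounds_cl_Suc_ivl
    by (rule prod.cong) (simp_all add: G_def w_def mult_ac)
  then have 2: "(\<Prod>i = Suc s + 1..Suc n. z i powi (2 * int i - 2 * int (Suc s) - int t) *
      (1 - inverse (z i)) ^ Suc s) = (\<Prod>i = s + 1..n. G i) * (\<Prod>i = s + 1..n. w i)"
    by (simp add: prod.distrib)
  have "(\<Prod>q = 1..n. (1 - z 1 + z 1 * z (Suc q)) / (z (Suc q) - z 1)) = (\<Prod>q = 1..n. inverse (w q))"
  proof (rule prod.cong)
    fix q assume "q \<in> {1..n}"
    then have "z (Suc q) \<noteq> 0" "z (Suc q) - 1 \<noteq> 0"
      using nz[of q] unfolding n(2) by auto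
    then show "(1 - z 1 + z 1 * z (Suc q)) / (z (Suc q) - z 1) = inverse (w q)"
      unfolding w_def z1 by (simp add: field_simps)
  qed simp
  then have 3: "(\<Prod>(p, q)\<in>{(p, q). 1 \<le> p \<and> p < q \<and> q \<le> Suc n}. (1 - z p + z p * z q) / (z q - z p)) =
      inverse (\<Prod>i = 1..n. w i) * Q"
    using prod_inversef[of w "{1..n}"]
    by (simp add: prod_pairs_shift Q_def comp_def del: One_nat_def)
  have W: "(\<Prod>i = 1..n. w i) = (\<Prod>i = 1..s. w i) * (\<Prod>i = s + 1..n. w i)"
    using prod.ub_add_nat[of 1 s w "n - s"] n by simp
  \<comment> \<open>Coordinates different from 1 make every \<open>w i\<close> nonzero, so that
    their product cancels against its inverse in the pair factors.\<close>
  have "(\<Prod>i = 1..n. w i) \<noteq> 0"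
    using nz unfolding n(2) by (auto simp: w_def)
  then have "P (Suc s) t z = (\<Prod>i = 1..s. F i) * (\<Prod>i = s + 1..n. G i) * Q"
    unfolding P_def n 1 2 3 W by (simp add: field_simps)
  also have "\<dots> = P s t (\<lambda>i. z (Suc i))"
    unfolding P_def n(2) F_def G_def Q_def w_def ..
  finally show ?thesis .
qed

text \<open>By \<open>P_Suc_eq_0\<close> only permutations fixing 1 contribute. They are the
  permutations of \<open>{2..Suc n}\<close>, which conjugation with \<open>Suc\<close> matches with
  those of \<open>{1..n}\<close>, and \<open>P_Suc_at_1\<close> matches the summands.\<close>

lemma R_Suc_at_1:
  assumes "t \<ge> 1" and z1: "z 1 = 1"
    and nz: "\<And>i. i \<in> {1..s + t - 1} \<Longrightarrow> z (Suc i) \<noteq> 0 \<and> z (Suc i) \<noteq> 1"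
  shows "R (Suc s) t z = R s t (\<lambda>i. z (Suc i))"
proof -
  define n where "n = s + t - 1"
  have n: "Suc s + t - 1 = Suc n" "s + t - 1 = n" "s + t = Suc n"
    using \<open>t \<ge> 1\<close> by (auto simp: n_def)
  let ?f = "\<lambda>\<sigma>. P (Suc s) t (\<lambda>i. z (\<sigma> i))"
  have "R (Suc s) t z = (\<Sum>\<sigma> | \<sigma> permutes {1..Suc n}. ?f \<sigma>)"
    by (simp add: R_def Sym_def n)
  also have "\<dots> = (\<Sum>\<sigma> | \<sigma> permutes {2..Suc n}. ?f \<sigma>)"
  proof (rule sum.mono_neutral_right)
    show "finite {\<sigma>. \<sigma> permutes {1..Suc n}}"
      by (simp add: finite_permutations)
    show "{\<sigma>. \<sigma> permutes {2..Suc n}} \<subseteq> {\<sigma>. \<sigma> permutes {1..Suc n}}"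
      by (auto intro: permutes_subset)
    show "\<forall>\<sigma>\<in>{\<sigma>. \<sigma> permutes {1..Suc n}} - {\<sigma>. \<sigma> permutes {2..Suc n}}. ?f \<sigma> = 0"
    proof
      fix \<sigma> assume "\<sigma> \<in> {\<sigma>. \<sigma> permutes {1..Suc n}} - {\<sigma>. \<sigma> permutes {2..Suc n}}"
      then have \<sigma>: "\<sigma> permutes {1..Suc n}" "\<not> \<sigma> permutes {2..Suc n}"
        by auto
      have "\<sigma> 1 \<noteq> 1"
      proof
        assume "\<sigma> 1 = 1"
        then have "\<sigma> permutes {2..Suc n}"
          by (intro permutes_superset[OF \<sigma>(1)]) (auto simp: le_eq_less_or_eq)
        with \<sigma>(2) show False ..
      qed
      \<comment> \<open>\<open>i\<close> is the position into which \<open>z 1\<close> is moved; it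
        is not the first, so the summand vanishes.\<close>
      obtain i where i: "i \<in> {1..Suc n}" "\<sigma> i = 1"
        using permutes_image[OF \<sigma>(1)] by (metis atLeastAtMost_iff imageE le_add1 le_refl plus_1_eq_Suc)
      with \<open>\<sigma> 1 \<noteq> 1\<close> have "i \<in> {2..s + t}"
        by (cases "i = 1") (auto simp: n)
      then show "?f \<sigma> = 0"
        using i z1 \<open>t \<ge> 1\<close> by (intro P_Suc_eq_0[of _ i]) auto
    qed
  qed
  also have "\<dots> = (\<Sum>\<pi> | \<pi> permutes {1..n}. P s t (\<lambda>i. z (Suc (\<pi> i))))"
  proof -
    \<comment> \<open>Conjugation by \<open>Suc\<close>, extended by the identity, in the form in
      which \<open>bij_betw_permutations\<close> provides it.\<close>
    let ?g = "\<lambda>\<pi> x. if x \<in> {2..Suc n} then Suc (\<pi> (inv_into {1..n} Suc x)) else x"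
    have "bij_betw Suc {1..n} {2..Suc n}"
      by (simp add: bij_betw_def image_Suc_atLeastAtMost numeral_2_eq_2)
    then have bij: "bij_betw ?g {\<pi>. \<pi> permutes {1..n}} {\<sigma>. \<sigma> permutes {2..Suc n}}"
      by (rule bij_betw_permutations)
    have g: "?g \<pi> 1 = 1" "i \<in> {1..n} \<Longrightarrow> ?g \<pi> (Suc i) = Suc (\<pi> i)" for \<pi> i
      by (auto simp: inv_into_f_f)
    have "?f (?g \<pi>) = P s t (\<lambda>i. z (Suc (\<pi> i)))" if "\<pi> permutes {1..n}" for \<pi>
    proof -
      have "?f (?g \<pi>) = P s t (\<lambda>i. z (?g \<pi> (Suc i)))"
      proof (rule P_Suc_at_1[OF \<open>t \<ge> 1\<close>])
        show "z (?g \<pi> 1) = 1"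
          using z1 by simp
        fix i assume "i \<in> {1..s + t - 1}"
        then have "i \<in> {1..n}" "\<pi> i \<in> {1..n}"
          using permutes_in_image[OF that, of i] unfolding n(2) by blast+
        then show "z (?g \<pi> (Suc i)) \<noteq> 0 \<and> z (?g \<pi> (Suc i)) \<noteq> 1"
          unfolding g(2)[OF \<open>i \<in> {1..n}\<close>] by (intro nz, unfold n(2))
      qed
      also have "\<dots> = P s t (\<lambda>i. z (Suc (\<pi> i)))"
        by (rule P_cong[OF \<open>t \<ge> 1\<close>]) (subst g(2), simp_all only: n(2))
      finally show ?thesis .
    qed
    then show ?thesis
      by (subst sum.reindex_bij_betw[OF bij, symmetric]) (auto intro!: sum.cong)
  qed
  also have "\<dots> = R s t (\<lambda>i. z (Suc i))"
    by (simp add: R_def Sym_def n)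
  finally show ?thesis .
qed

section \<open>Descent from \<open>s + 1\<close> to \<open>s\<close>\<close>

lemma rvar_neq_1: "(rvar i :: 'k :: field ratfun) \<noteq> 1"
proof
  assume "(rvar i :: 'k ratfun) = 1"
  then have "(Poly_Mapping.single (Poly_Mapping.single i (1::nat)) (1::'k)) = Poly_Mapping.single 0 1"
    by (simp add: rvar_def One_fract_def eq_fract)
  then have "Poly_Mapping.single i (1::nat) = 0"
    by (metis lookup_single_eq lookup_single_not_eq zero_neq_one)
  then show False
    by (metis lookup_single_eq lookup_zero zero_neq_one)
qed

lemma point_evaluation_Fract_single:
  "point_evaluation (\<lambda>c :: 'k :: field. Fract (Poly_Mapping.single 0 c) 1 :: 'k ratfun)"
  by standard (simp_all add: Zero_fract_def One_fract_def single_add mult_single)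

text \<open>The identity for \<open>Suc s\<close> is specialized at a point whose first coordinate
  is 1. Inverting the coordinates keeps that 1, so \<open>R_Suc_at_1\<close> reduces both sides to
  \<open>R s t\<close>.\<close>

lemma R_inverse_descend:
  assumes "R (Suc s) t (rvar :: nat \<Rightarrow> 'k :: field ratfun) = R (Suc s) t (\<lambda>i. inverse (rvar i))"
    and "t \<ge> 1"
  shows "R s t (rvar :: nat \<Rightarrow> 'k ratfun) = R s t (\<lambda>i. inverse (rvar i))"
proof -
  \<comment> \<open>The point \<open>(1, rvar 1, rvar 2, ...)\<close>, indexed from 1; the entry at
    0 is never read by \<open>R\<close>.\<close>
  define a :: "nat \<Rightarrow> 'k ratfun" where "a i = (if i = 1 then 1 else rvar (i - 1))" for i
  have a: "a 1 = 1" "i \<ge> 1 \<Longrightarrow> a (Suc i) = rvar i" for i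
    by (auto simp: a_def)
  \<comment> \<open>\<open>\<lambda>i. a (Suc i)\<close> and \<open>rvar\<close> differ at index 0,
    where the former is 1, so a congruence from index 1 on is called for.\<close>
  have R_cong: "R s t x = R s t y" if "\<And>i. i \<ge> 1 \<Longrightarrow> x i = y i" for x y :: "nat \<Rightarrow> 'k ratfun"
    unfolding R_def Sym_def
  proof (intro sum.cong P_cong \<open>t \<ge> 1\<close> that)
    fix \<sigma> i assume "\<sigma> \<in> {\<sigma>. \<sigma> permutes {1..s + t - 1}}" "i \<in> {1..s + t - 1}"
    then show "1 \<le> \<sigma> i"
      using permutes_in_image[of \<sigma> "{1..s + t - 1}" i] by simp
  qed simp
  have "inj_on a {1..Suc s + t - 1}"
    by (auto simp: inj_on_def a_def rvar_eq_iff rvar_neq_1 rvar_neq_1[symmetric])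
  then have "R (Suc s) t a = R (Suc s) t (\<lambda>i. inverse (a i))"
    by (intro R_inverse_specialize[OF point_evaluation_Fract_single assms(1)])
      (use assms(2) in \<open>auto simp: a_def rvar_nonzero\<close>)
  moreover have "R (Suc s) t a = R s t (\<lambda>i. a (Suc i))"
    using assms(2) by (intro R_Suc_at_1) (auto simp: a rvar_nonzero rvar_neq_1 simp del: One_nat_def)
  moreover have "R (Suc s) t (\<lambda>i. inverse (a i)) = R s t (\<lambda>i. inverse (a (Suc i)))"
    using assms(2) by (intro R_Suc_at_1) (auto simp: a rvar_nonzero rvar_neq_1 simp del: One_nat_def)
  moreover have "R s t (\<lambda>i. a (Suc i)) = R s t rvar"
    "R s t (\<lambda>i. inverse (a (Suc i))) = R s t (\<lambda>i. inverse (rvar i))"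
    by (auto intro!: R_cong simp: a simp del: One_nat_def)
  ultimately show ?thesis
    by simp
qed

theorem theorem1p3:
  assumes "\<And>s. s \<ge> 1 \<Longrightarrow>
      R s s (rvar :: nat \<Rightarrow> 'k :: field_char_0 ratfun) = R s s (\<lambda>i. inverse (rvar i))"
    and "\<And>s. s \<ge> 1 \<Longrightarrow>
      R s (s + 1) (rvar :: nat \<Rightarrow> 'k ratfun) = R s (s + 1) (\<lambda>i. inverse (rvar i))"
    and "1 \<le> s" and "s \<le> t"
  shows "R s t (rvar :: nat \<Rightarrow> 'k ratfun) = R s t (\<lambda>i. inverse (rvar i))"
  using \<open>s \<le> t\<close> \<open>1 \<le> s\<close>
\<comment> \<open>Downward induction on \<open>s\<close> with \<open>t\<close> fixed, starting from
  the diagonal \<open>s = t\<close>. The bound \<open>1 \<le> s\<close> stays in the induction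
  predicate; at the start it gives \<open>1 \<le> t\<close>.\<close>
proof (induction rule: inc_induct)
  case base
  then show ?case
    by (rule assms(1))
next
  case (step s)
  show ?case
  proof (rule R_inverse_descend)
    show "R (Suc s) t (rvar :: nat \<Rightarrow> 'k ratfun) = R (Suc s) t (\<lambda>i. inverse (rvar i))"
      by (rule step.IH) simp
  qed (use step in simp_all)
qed

end
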